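(* Let $L>0$, let $f:[0,1]\to[0,1]$ be $L$-Lipschitz, and let $(t_n)$ and $(x_n)$ be sequences in $[0,1]$ such that for all $n$, $x_{n+1}=(1-t_n)x_n+t_nf(x_n)$. Define, for any suitable $\varepsilon$, $g$, $\delta$, $m$, $n$: \begin{align*} h^g_m(n)&:=g(m+n)\\ P^{\varepsilon,g}_0&:=0\\ P^{\varepsilon,g}_{n+1}&:=P^{\varepsilon,g}_n+\widetilde{h^g_{P^{\varepsilon,g}_n}}^{\left(\left\lceil\frac1\varepsilon\right\rceil+1\right)}(0)\\ T_{\varepsilon,\delta}&:=\left\lceil\log_{\left(1-\frac\delta2\right)}\varepsilon\right\rceil+1\\ B_{\varepsilon,g,\delta}&:=T_{\varepsilon,\delta}+\widetilde{g}\left(P^{\varepsilon,g}_{T_{\varepsilon,\delta}}\right)+1\\ \Psi^{\mathrm{KM}}_\delta(\varepsilon,g)&:=P^{\varepsilon,g}_{B_{\varepsilon,g,\delta}}. \end{align*} Let $\delta\in(0,1)$ be such that for all $n$, $t_n\leq\frac{2-\delta}{L+1}$. Let $\varepsilon>0$ and $g:\mathbb{N}\to\mathbb{N}$. Then there is an $N\leq\Psi^{\mathrm{KM}}_\delta(\varepsilon,g)$ such that for all $i,j\in[N,N+g(N)]$, $|x_i-x_j|\leq\varepsilon$.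
   Context: $\mathbb{N}$ contains $0$; sequences are indexed by $\mathbb{N}$, and $N$, $i$, $j$ denote natural numbers, so $i,j\in[N,N+g(N)]$ means that $i,j$ are natural numbers with $N\leq i,j\leq N+g(N)$. For a real number $r$, $\lceil r\rceil$ is the least integer $\geq r$. For any $h:\mathbb{N}\to\mathbb{N}$, the function $\widetilde{h}:\mathbb{N}\to\mathbb{N}$ is defined, for all $n$, by $\widetilde{h}(n):=n+h(n)$. For $F:\mathbb{N}\to\mathbb{N}$ and $k\in\mathbb{N}$, $F^{(k)}$ denotes the $k$-fold composition of $F$ with itself; so $\widetilde{h^g_{P^{\varepsilon,g}_n}}^{(k)}(0)$ is the $k$-fold iterate at $0$ of the map $i\mapsto i+g(P^{\varepsilon,g}_n+i)$. A function $f:[0,1]\to[0,1]$ is $L$-Lipschitz if $|f(x)-f(y)|\leq L|x-y|$ for all $x,y\in[0,1]$. *)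

theory Defs
  imports "HOL-Analysis.Lipschitz"
begin

definition tilde :: "(nat \<Rightarrow> nat) \<Rightarrow> nat \<Rightarrow> nat" where
  "tilde h n = n + h n"

definition shift :: "(nat \<Rightarrow> nat) \<Rightarrow> nat \<Rightarrow> nat \<Rightarrow> nat" where
  "shift g m n = g (m + n)"

text \<open>For \<open>\<epsilon> > 0\<close> the ceiling below is positive, so \<open>nat\<close> does not truncate.\<close>

primrec P :: "real \<Rightarrow> (nat \<Rightarrow> nat) \<Rightarrow> nat \<Rightarrow> nat" where
  "P \<epsilon> g 0 = 0"
| "P \<epsilon> g (Suc n) = P \<epsilon> g n + (tilde (shift g (P \<epsilon> g n)) ^^ (nat \<lceil>1 / \<epsilon>\<rceil> + 1)) 0"

text \<open>
  For \<open>0 < \<delta> < 1\<close> the base of the logarithm lies strictly between \<open>1/2\<close> and \<open>1\<close>, so for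
  \<open>0 < \<epsilon> \<le> 1\<close> the integer inside \<open>nat\<close> is at least \<open>1\<close>. It can be negative only for
  \<open>\<epsilon> > 1\<close>; \<open>T\<close>, which serves as an index, is then \<open>0\<close>.
\<close>

definition T :: "real \<Rightarrow> real \<Rightarrow> nat" where
  "T \<epsilon> \<delta> = nat (\<lceil>log (1 - \<delta> / 2) \<epsilon>\<rceil> + 1)"

definition B :: "real \<Rightarrow> (nat \<Rightarrow> nat) \<Rightarrow> real \<Rightarrow> nat" where
  "B \<epsilon> g \<delta> = T \<epsilon> \<delta> + tilde g (P \<epsilon> g (T \<epsilon> \<delta>)) + 1"

definition Psi_KM :: "real \<Rightarrow> real \<Rightarrow> (nat \<Rightarrow> nat) \<Rightarrow> nat" where
  "Psi_KM \<delta> \<epsilon> g = P \<epsilon> g (B \<epsilon> g \<delta>)"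

end

theory Submission
  imports Defs
begin

text \<open>
  The iteration moves from \<open>x n\<close> in the direction of the residual \<open>f (x n) - x n\<close>, and the bound
  on the step sizes says that no step is longer than \<open>2 - \<delta>\<close> times the distance to any fixed point
  of \<open>f\<close>. Hence, if the residual changes its sign between two consecutive iterates \<open>u\<close> and \<open>v\<close>,
  then \<open>v\<close> overshoots each fixed point \<open>q\<close> between them in such a way that
  \<open>\<bar>v - q\<bar> \<le> (1 - \<delta>) * \<bar>q - u\<bar>\<close>. This inequality, together with the fact that the residuals at
  \<open>u\<close> and \<open>v\<close> point towards each other, is called a \<^emph>\<open>trap\<close> (\<open>trapped\<close> below). The iteration never
  leaves the segment between \<open>u\<close> and \<open>v\<close> again (\<open>trapped_forever\<close>), and the next sign change
  creates a new trap whose width is at most \<open>1 - \<delta>\<close> times the old one (\<open>trapped_step_le\<close>).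

  Let \<open>\<epsilon> < 1\<close>, as there is nothing to show otherwise. If the residual vanishes at some iterate,
  then the iteration is constant from there on. The interval from \<open>P \<epsilon> g n\<close> to \<open>P \<epsilon> g (Suc n)\<close>
  consists of \<open>\<lceil>1 / \<epsilon>\<rceil> + 1\<close> consecutive intervals of the form \<open>{N..N + g N}\<close>, any two neighbours
  sharing an endpoint. If the residual has constant sign there, then the iteration is monotone
  on it, and as it moves by at most \<open>1\<close> in total, it moves by at most \<open>\<epsilon>\<close> on one of these
  intervals (\<open>monotone_metastable\<close>). Otherwise there is a sign change. So, unless a suitable \<open>N\<close>
  is found earlier, at \<open>P \<epsilon> g n\<close> with \<open>n \<ge> 1\<close> the iteration is in a trap of width at most \<open>(1 -
  \<delta>) ^ (n - 1)\<close> (\<open>trap_width\<close>). For \<open>n = T \<epsilon> \<delta>\<close> the width is at most \<open>\<epsilon>\<close>, and \<open>N = P \<epsilon> g (T \<epsilon>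
  \<delta>)\<close> is suitable. As \<open>T \<epsilon> \<delta> \<le> B \<epsilon> g \<delta>\<close>, this \<open>N\<close> is at most \<open>Psi_KM \<delta> \<epsilon> g\<close>.
\<close>

section \<open>Monotone sequences\<close>

lemma funpow_tilde_shift:
  "a + (tilde (shift g a) ^^ k) 0 = (tilde g ^^ k) a"
proof (induction k)
  case (Suc k)
  then show ?case
    by (simp add: tilde_def shift_def flip: add.assoc)
qed simp

lemma P_Suc_eq: "P \<epsilon> g (Suc n) = (tilde g ^^ (nat \<lceil>1 / \<epsilon>\<rceil> + 1)) (P \<epsilon> g n)"
  by (simp only: P.simps funpow_tilde_shift)

lemma mono_P: "mono (P \<epsilon> g)"
  by (simp add: mono_iff_le_Suc)

lemma mono_funpow_tilde: "mono (\<lambda>k. (tilde g ^^ k) a)"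
  by (simp add: mono_iff_le_Suc tilde_def)

text \<open>The sequence \<open>x\<close> fluctuates by at most \<open>\<epsilon>\<close> on \<open>{N..N + g N}\<close>.\<close>

definition metastable :: "real \<Rightarrow> (nat \<Rightarrow> nat) \<Rightarrow> (nat \<Rightarrow> real) \<Rightarrow> nat \<Rightarrow> bool" where
  "metastable \<epsilon> g x N \<longleftrightarrow> (\<forall>i \<in> {N..N + g N}. \<forall>j \<in> {N..N + g N}. \<bar>x i - x j\<bar> \<le> \<epsilon>)"

text \<open>An increasing sequence rises by more than \<open>\<epsilon>\<close> on each interval \<open>{N..N + g N}\<close> on which it
  is not metastable; the intervals starting at \<open>a\<close>, \<open>tilde g a\<close>, \<open>tilde g (tilde g a)\<close>, \<open>\<dots>\<close> have
  only endpoints in common, so the rises add up.\<close>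

lemma mono_on_rise:
  fixes x :: "nat \<Rightarrow> real"
  assumes "mono_on {a..(tilde g ^^ k) a} x"
    and "\<And>i. i < k \<Longrightarrow> \<not> metastable \<epsilon> g x ((tilde g ^^ i) a)"
  shows "real k * \<epsilon> \<le> x ((tilde g ^^ k) a) - x a"
  using assms
proof (induction k)
  case (Suc k)
  define N where "N = (tilde g ^^ k) a"
  have N': "(tilde g ^^ Suc k) a = N + g N"
    by (simp add: N_def tilde_def)
  have aN: "a \<le> N"
    using monoD[OF mono_funpow_tilde[of g a], of 0 k] by (simp add: N_def)
  have mono: "mono_on {a..N + g N} x"
    using Suc.prems(1) N' by simp
  have "real k * \<epsilon> \<le> x N - x a"
    unfolding N_def
  proof (rule Suc.IH)
    show "mono_on {a..(tilde g ^^ k) a} x"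
      using mono by (rule mono_on_subset) (simp add: N_def)
  qed (use Suc.prems(2) in simp)
  moreover have "\<epsilon> < x (N + g N) - x N"
  proof -
    have "\<not> metastable \<epsilon> g x N"
      using Suc.prems(2) by (simp add: N_def)
    then obtain i j where ij: "i \<in> {N..N + g N}" "j \<in> {N..N + g N}" "\<epsilon> < \<bar>x i - x j\<bar>"
      by (auto simp: metastable_def not_le)
    have "x N \<le> x l \<and> x l \<le> x (N + g N)" if "l \<in> {N..N + g N}" for l
      using mono_onD[OF mono, of N l] mono_onD[OF mono, of l "N + g N"] that aN by auto
    from this[OF ij(1)] this[OF ij(2)] ij(3) show ?thesis
      by linarith
  qed
  ultimately show ?case
    unfolding N' by (simp add: algebra_simps)
qed simp

lemma monotone_metastable:
  fixes x :: "nat \<Rightarrow> real"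
  assumes "\<epsilon> > 0" and "\<And>n. x n \<in> {0..1}"
    and "mono_on {P \<epsilon> g n..P \<epsilon> g (Suc n)} x"
  shows "\<exists>N \<le> P \<epsilon> g (Suc n). metastable \<epsilon> g x N"
proof (rule ccontr)
  assume bad: "\<not> ?thesis"
  define K where "K = nat \<lceil>1 / \<epsilon>\<rceil> + 1"
  have PS: "P \<epsilon> g (Suc n) = (tilde g ^^ K) (P \<epsilon> g n)"
    unfolding K_def by (rule P_Suc_eq)
  have "real K * \<epsilon> \<le> x ((tilde g ^^ K) (P \<epsilon> g n)) - x (P \<epsilon> g n)"
  proof (rule mono_on_rise)
    show "\<not> metastable \<epsilon> g x ((tilde g ^^ i) (P \<epsilon> g n))" if "i < K" for i
      using bad monoD[OF mono_funpow_tilde[of g "P \<epsilon> g n"], of i K] that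
      unfolding PS by simp
  qed (use assms(3) PS in simp)
  also have "\<dots> \<le> 1"
    using assms(2)[of "(tilde g ^^ K) (P \<epsilon> g n)"] assms(2)[of "P \<epsilon> g n"] by simp
  finally have "real K * \<epsilon> \<le> 1" .
  moreover have "1 / \<epsilon> < real K"
    unfolding K_def by linarith
  ultimately show False
    using assms(1) by (simp add: field_simps)
qed

section \<open>Traps\<close>

text \<open>The iteration is currently at \<open>u\<close>, and \<open>y\<close> is the iterate from which it last crossed a fixed
  point with a change of sign of the residual \<open>f a - a\<close>. The residuals at \<open>y\<close> and \<open>u\<close> point
  towards each other, and \<open>u\<close> is closer than \<open>y\<close> to each fixed point between them, by a factor of
  \<open>1 - \<delta>\<close>. No order between \<open>y\<close> and \<open>u\<close> is prescribed, so that crossings in both directions are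
  covered.\<close>

definition trapped :: "real \<Rightarrow> (real \<Rightarrow> real) \<Rightarrow> real \<Rightarrow> real \<Rightarrow> bool" where
  "trapped \<delta> f y u \<longleftrightarrow>
     (f y - y) * (u - y) > 0 \<and> (f u - u) * (y - u) > 0 \<and>
     (\<forall>q \<in> closed_segment y u. f q = q \<longrightarrow> \<bar>u - q\<bar> \<le> (1 - \<delta>) * \<bar>q - y\<bar>)"

lemma fixed_point_between:
  fixes f :: "real \<Rightarrow> real"
  assumes cont: "continuous_on (closed_segment y u) f"
    and "(f y - y) * (u - y) > 0" and "(f u - u) * (y - u) > 0"
  shows "\<exists>q \<in> closed_segment y u. f q = q"
proof -
  have cont': "continuous_on (closed_segment y u) (\<lambda>a. f a - a)"
    by (intro continuous_intros cont)
  show ?thesis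
  proof (cases "y \<le> u")
    case True
    then have "\<exists>q. y \<le> q \<and> q \<le> u \<and> f q - q = 0"
      using assms(2,3) cont' by (intro IVT2') (auto simp: zero_less_mult_iff closed_segment_eq_real_ivl)
    with True show ?thesis
      by (auto simp: closed_segment_eq_real_ivl)
  next
    case False
    then have "\<exists>q. u \<le> q \<and> q \<le> y \<and> f q - q = 0"
      using assms(2,3) cont' by (intro IVT2') (auto simp: zero_less_mult_iff closed_segment_eq_real_ivl)
    with False show ?thesis
      by (auto simp: closed_segment_eq_real_ivl)
  qed
qed

text \<open>A Krasnoselskii--Mann iteration of an \<open>L\<close>-Lipschitz map on the unit interval, with step sizes
  that stay below \<open>2 / (L + 1)\<close> by at least \<open>\<delta> / (L + 1)\<close>.\<close>

locale krasnoselskii_mann =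
  fixes L \<delta> :: real and f :: "real \<Rightarrow> real" and t x :: "nat \<Rightarrow> real"
  assumes L_pos: "L > 0"
    and lipschitz: "L-lipschitz_on {0..1} f"
    and t_nonneg: "\<And>n. t n \<ge> 0"
    and x_unit: "\<And>n. x n \<in> {0..1}"
    and x_Suc: "\<And>n. x (Suc n) = (1 - t n) * x n + t n * f (x n)"
    and \<delta>_pos: "0 < \<delta>" and \<delta>_less: "\<delta> < 1"
    and t_le: "\<And>n. t n \<le> (2 - \<delta>) / (L + 1)"
begin

lemma x_diff: "x (Suc n) - x n = t n * (f (x n) - x n)"
  by (simp add: x_Suc algebra_simps)

lemma step_le_fixed_point:
  assumes q: "q \<in> {0..1}" "f q = q"
  shows "\<bar>x (Suc n) - x n\<bar> \<le> (2 - \<delta>) * \<bar>q - x n\<bar>"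
proof -
  have "\<bar>f (x n) - f q\<bar> \<le> L * \<bar>x n - q\<bar>"
    using lipschitz_onD[OF lipschitz x_unit q(1)] by (simp add: dist_real_def)
  then have "\<bar>f (x n) - x n\<bar> \<le> (L + 1) * \<bar>q - x n\<bar>"
    using q(2) by (simp add: algebra_simps abs_minus_commute)
  then have "\<bar>x (Suc n) - x n\<bar> \<le> t n * ((L + 1) * \<bar>q - x n\<bar>)"
    by (simp add: x_diff abs_mult t_nonneg mult_left_mono)
  also have "\<dots> = t n * (L + 1) * \<bar>q - x n\<bar>"
    by simp
  also have "\<dots> \<le> (2 - \<delta>) * \<bar>q - x n\<bar>"
    using t_le[of n] L_pos by (intro mult_right_mono) (simp_all add: field_simps)
  finally show ?thesis .
qed

lemma fixed_point_stays:
  assumes "f (x n) = x n" and "n \<le> i"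
  shows "x i = x n"
  using assms(2) by (induction i rule: dec_induct) (use assms(1) in \<open>simp_all add: x_Suc algebra_simps\<close>)

lemma fixed_point_metastable:
  assumes "f (x n) = x n" and "\<epsilon> > 0"
  shows "metastable \<epsilon> g x n"
  unfolding metastable_def
proof (intro ballI)
  fix i j assume "i \<in> {n..n + g n}" "j \<in> {n..n + g n}"
  then have "x i = x n" "x j = x n"
    by (auto intro!: fixed_point_stays[OF assms(1)])
  with assms(2) show "\<bar>x i - x j\<bar> \<le> \<epsilon>"
    by simp
qed

lemma sign_change_trapped:
  assumes "(f (x n) - x n) * (f (x (Suc n)) - x (Suc n)) < 0"
  shows "trapped \<delta> f (x n) (x (Suc n))"
proof -
  define d where "d = f (x n) - x n"
  define e where "e = f (x (Suc n)) - x (Suc n)"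
  have de: "d * e < 0"
    using assms by (simp add: d_def e_def)
  have step: "x (Suc n) = x n + t n * d"
    using x_diff[of n] by (simp add: d_def)
  have "t n \<noteq> 0"
  proof
    assume "t n = 0"
    then have "e = d"
      by (simp add: step d_def e_def)
    with de show False
      using not_square_less_zero by blast
  qed
  with t_nonneg[of n] have t: "t n > 0"
    by simp
  have "d * (x (Suc n) - x n) > 0"
    using de t by (auto simp: step zero_less_mult_iff mult_less_0_iff)
  moreover have "e * (x n - x (Suc n)) > 0"
    using de t by (auto simp: step zero_less_mult_iff mult_less_0_iff)
  moreover have "\<bar>x (Suc n) - q\<bar> \<le> (1 - \<delta>) * \<bar>q - x n\<bar>"
    if q: "q \<in> closed_segment (x n) (x (Suc n))" "f q = q" for q
  proof -
    have "q \<in> {0..1}"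
      using q(1) x_unit[of n] x_unit[of "Suc n"] by (auto simp: closed_segment_eq_real_ivl split: if_splits)
    from step_le_fixed_point[OF this q(2), of n]
    have "\<bar>x (Suc n) - x n\<bar> \<le> (1 - \<delta>) * \<bar>q - x n\<bar> + \<bar>q - x n\<bar>"
      by (simp add: algebra_simps)
    moreover have "\<bar>x (Suc n) - x n\<bar> = \<bar>x (Suc n) - q\<bar> + \<bar>q - x n\<bar>"
      using q(1) by (auto simp: closed_segment_eq_real_ivl split: if_splits)
    ultimately show ?thesis
      by linarith
  qed
  ultimately show ?thesis
    unfolding trapped_def d_def e_def by blast
qed

text \<open>This holds for every step out of a trap. If the residual changes its sign in the step, then
  the left-hand side is the width of the new trap.\<close>

lemma trapped_step_le:
  assumes tr: "trapped \<delta> f y (x n)" and y: "y \<in> {0..1}"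
  shows "\<bar>x (Suc n) - x n\<bar> \<le> (1 - \<delta>) * \<bar>x n - y\<bar>"
proof -
  have seg: "closed_segment y (x n) \<subseteq> {0..1}"
    using y x_unit[of n] by (auto simp: closed_segment_eq_real_ivl split: if_splits)
  have "continuous_on (closed_segment y (x n)) f"
    using lipschitz_on_continuous_on[OF lipschitz] seg by (rule continuous_on_subset)
  then obtain q where q: "q \<in> closed_segment y (x n)" "f q = q"
    using tr fixed_point_between unfolding trapped_def by blast
  have "\<bar>x (Suc n) - x n\<bar> \<le> (2 - \<delta>) * \<bar>q - x n\<bar>"
    using q seg by (intro step_le_fixed_point) auto
  also have "\<dots> = \<bar>x n - q\<bar> + (1 - \<delta>) * \<bar>x n - q\<bar>"
    by (simp add: algebra_simps abs_minus_commute)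
  also have "\<dots> \<le> (1 - \<delta>) * \<bar>q - y\<bar> + (1 - \<delta>) * \<bar>x n - q\<bar>"
    using tr q unfolding trapped_def by simp
  also have "\<dots> = (1 - \<delta>) * (\<bar>q - y\<bar> + \<bar>x n - q\<bar>)"
    by (simp add: algebra_simps)
  also have "\<bar>q - y\<bar> + \<bar>x n - q\<bar> = \<bar>x n - y\<bar>"
    using q(1) by (auto simp: closed_segment_eq_real_ivl split: if_splits)
  finally show ?thesis .
qed

text \<open>The segment is left open at \<open>y\<close>, because the residual at \<open>y\<close> has to point strictly towards
  the next iterate.\<close>

lemma trapped_step_inside:
  assumes tr: "trapped \<delta> f y (x n)" and y: "y \<in> {0..1}"
  shows "x (Suc n) \<in> closed_segment y (x n) - {y}"
proof -
  have "(f (x n) - x n) * (y - x n) > 0"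
    using tr by (simp add: trapped_def)
  then have ne: "y \<noteq> x n" and side: "(x (Suc n) - x n) * (y - x n) \<ge> 0"
    using t_nonneg[of n] by (auto simp: x_diff mult.assoc)
  have "(1 - \<delta>) * \<bar>x n - y\<bar> < \<bar>x n - y\<bar>"
    using ne \<delta>_pos by simp
  with trapped_step_le[OF assms] have "\<bar>x (Suc n) - x n\<bar> < \<bar>x n - y\<bar>"
    by linarith
  with side ne show ?thesis
    by (auto simp: closed_segment_eq_real_ivl zero_le_mult_iff)
qed

lemma trapped_Suc:
  assumes tr: "trapped \<delta> f y (x n)" and y: "y \<in> {0..1}"
    and same: "(f (x n) - x n) * (f (x (Suc n)) - x (Suc n)) > 0"
  shows "trapped \<delta> f y (x (Suc n))"
proof -
  have ins: "x (Suc n) \<in> closed_segment y (x n) - {y}"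
    using tr y by (rule trapped_step_inside)
  have "(f y - y) * (x n - y) > 0" "(f (x n) - x n) * (y - x n) > 0"
    using tr by (auto simp: trapped_def)
  with ins same have "(f y - y) * (x (Suc n) - y) > 0"
      "(f (x (Suc n)) - x (Suc n)) * (y - x (Suc n)) > 0"
    by (auto simp: closed_segment_eq_real_ivl zero_less_mult_iff split: if_splits)
  moreover have "\<bar>x (Suc n) - q\<bar> \<le> (1 - \<delta>) * \<bar>q - y\<bar>"
    if q: "q \<in> closed_segment y (x (Suc n))" "f q = q" for q
  proof -
    have "q \<in> closed_segment y (x n)" "\<bar>x (Suc n) - q\<bar> \<le> \<bar>x n - q\<bar>"
      using q(1) ins by (auto simp: closed_segment_eq_real_ivl split: if_splits)
    with q(2) tr show ?thesis
      unfolding trapped_def by force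
  qed
  ultimately show ?thesis
    unfolding trapped_def by blast
qed

text \<open>Traps are nested, so the iteration stays in the first one; it remains trapped unless it hits
  a fixed point.\<close>

lemma trapped_forever:
  assumes tr: "trapped \<delta> f y (x n)" and y: "y \<in> {0..1}" and "n \<le> i"
  shows "x i \<in> closed_segment y (x n) \<and>
    (f (x i) = x i \<or> (\<exists>z \<in> closed_segment y (x n). trapped \<delta> f z (x i)))"
  using \<open>n \<le> i\<close>
proof (induction i rule: dec_induct)
  case base
  show ?case
    using tr by auto
next
  case (step i)
  have sub: "closed_segment y (x n) \<subseteq> {0..1}"
    using y x_unit[of n] by (auto simp: closed_segment_eq_real_ivl split: if_splits)
  show ?case
  proof (cases "f (x i) = x i")
    case True
    then have "x (Suc i) = x i"
      by (intro fixed_point_stays) auto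
    then show ?thesis
      using step.IH True by simp
  next
    case False
    with step.IH obtain z where z: "z \<in> closed_segment y (x n)" "trapped \<delta> f z (x i)"
      by blast
    with sub have z01: "z \<in> {0..1}"
      by blast
    have "x (Suc i) \<in> closed_segment z (x i)"
      using trapped_step_inside[OF z(2) z01] by blast
    moreover have "closed_segment z (x i) \<subseteq> closed_segment y (x n)"
      using z(1) step.IH by (simp add: subset_closed_segment)
    ultimately have "x (Suc i) \<in> closed_segment y (x n)"
      by blast
    moreover consider "f (x (Suc i)) = x (Suc i)"
      | "(f (x i) - x i) * (f (x (Suc i)) - x (Suc i)) > 0"
      | "(f (x i) - x i) * (f (x (Suc i)) - x (Suc i)) < 0"
      using False by (metis eq_iff_diff_eq_0 linorder_neqE_linordered_idom mult_eq_0_iff)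
    then have "f (x (Suc i)) = x (Suc i) \<or> (\<exists>z \<in> closed_segment y (x n). trapped \<delta> f z (x (Suc i)))"
      by cases (use z trapped_Suc[OF z(2) z01] sign_change_trapped[of i] step.IH in blast)+
    ultimately show ?thesis
      by blast
  qed
qed

lemma trapped_later:
  assumes tr: "trapped \<delta> f y (x n)" and y: "y \<in> {0..1}" and "n \<le> i" and "f (x i) \<noteq> x i"
  shows "\<exists>z \<in> {0..1}. trapped \<delta> f z (x i) \<and> \<bar>x i - z\<bar> \<le> \<bar>x n - y\<bar>"
proof -
  obtain z where z: "z \<in> closed_segment y (x n)" "trapped \<delta> f z (x i)"
      "x i \<in> closed_segment y (x n)"
    using trapped_forever[OF assms(1-3)] assms(4) by blast
  then have "z \<in> {0..1}" "\<bar>x i - z\<bar> \<le> \<bar>x n - y\<bar>"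
    using y x_unit[of n] by (auto simp: closed_segment_eq_real_ivl split: if_splits)
  with z(2) show ?thesis
    by blast
qed

lemma trapped_metastable:
  assumes tr: "trapped \<delta> f y (x n)" and y: "y \<in> {0..1}" and "\<bar>x n - y\<bar> \<le> \<epsilon>"
  shows "metastable \<epsilon> g x n"
  unfolding metastable_def
proof (intro ballI)
  fix i j assume "i \<in> {n..n + g n}" "j \<in> {n..n + g n}"
  then have "x i \<in> closed_segment y (x n)" "x j \<in> closed_segment y (x n)"
    using trapped_forever[OF tr y] by auto
  with assms(3) show "\<bar>x i - x j\<bar> \<le> \<epsilon>"
    by (auto simp: closed_segment_eq_real_ivl split: if_splits)
qed

section \<open>Counting sign changes\<close>

lemma sign_change_exists:
  assumes \<epsilon>: "\<epsilon> > 0" and bad: "\<And>N. N \<le> P \<epsilon> g (Suc n) \<Longrightarrow> \<not> metastable \<epsilon> g x N"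
  shows "\<exists>k. P \<epsilon> g n \<le> k \<and> Suc k \<le> P \<epsilon> g (Suc n) \<and>
    (f (x k) - x k) * (f (x (Suc k)) - x (Suc k)) < 0"
proof (rule ccontr)
  assume none: "\<not> ?thesis"
  define a b where "a = P \<epsilon> g n" and "b = P \<epsilon> g (Suc n)"
  define d where "d i = f (x i) - x i" for i
  have d0: "d i \<noteq> 0" if "i \<le> b" for i
    using fixed_point_metastable[OF _ \<epsilon>, of i g] bad[of i] that by (auto simp: d_def b_def)
  have dS: "d i * d (Suc i) > 0" if "a \<le> i" "Suc i \<le> b" for i
    using none that d0[of i] d0[of "Suc i"]
    by (metis (no_types, lifting) a_def b_def d_def Suc_leD linorder_neqE_linordered_idom mult_eq_0_iff)
  have sign: "d a * d i > 0" if "a \<le> i" "i \<le> b" for i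
    using that
  proof (induction i rule: dec_induct)
    case base
    then show ?case
      using d0[of a] by (simp add: zero_less_mult_iff linorder_neq_iff disj_commute)
  next
    case (step i)
    then show ?case
      using dS[of i] by (auto simp: zero_less_mult_iff)
  qed
  \<comment> \<open>A decreasing sequence in the unit interval is reflected to an increasing one.\<close>
  define y where "y i = (if d a > 0 then x i else 1 - x i)" for i
  have yS: "y i \<le> y (Suc i)" if "a \<le> i" "i \<le> b" for i
  proof -
    have "d a * (x (Suc i) - x i) \<ge> 0"
      using sign[OF that] t_nonneg[of i] mult_nonneg_nonneg[of "t i" "d a * d i"]
      by (simp add: x_diff d_def algebra_simps)
    then show ?thesis
      using sign[of i] that by (auto simp: y_def zero_le_mult_iff)
  qed
  have "y i \<le> y j" if "a \<le> i" "i \<le> j" "j \<le> b" for i j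
    using that(2,3)
  proof (induction j rule: dec_induct)
    case (step j)
    then show ?case
      using yS[of j] that(1) by simp
  qed simp
  then have "mono_on {a..b} y"
    by (auto intro!: mono_onI)
  then have "\<exists>N \<le> b. metastable \<epsilon> g y N"
    using monotone_metastable[OF \<epsilon>, of y g n] x_unit by (auto simp: a_def b_def y_def)
  moreover have "metastable \<epsilon> g y N \<longleftrightarrow> metastable \<epsilon> g x N" for N
    by (auto simp: metastable_def y_def abs_minus_commute)
  ultimately show False
    using bad by (auto simp: b_def)
qed

text \<open>After \<open>Suc n\<close> blocks there have been at least \<open>Suc n\<close> sign changes; the first trap has width
  at most \<open>1\<close>, and each of the \<open>n\<close> others shrinks the width by the factor \<open>1 - \<delta>\<close>.\<close>

lemma trap_width:
  assumes \<epsilon>: "\<epsilon> > 0" and "\<And>N. N \<le> P \<epsilon> g (Suc n) \<Longrightarrow> \<not> metastable \<epsilon> g x N"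
  shows "\<exists>y \<in> {0..1}. trapped \<delta> f y (x (P \<epsilon> g (Suc n))) \<and>
    \<bar>x (P \<epsilon> g (Suc n)) - y\<bar> \<le> (1 - \<delta>) ^ n"
  using assms(2)
proof (induction n)
  case 0
  obtain k where k: "Suc k \<le> P \<epsilon> g (Suc 0)"
      "(f (x k) - x k) * (f (x (Suc k)) - x (Suc k)) < 0"
    using sign_change_exists[OF \<epsilon> 0] by blast
  have "f (x (P \<epsilon> g (Suc 0))) \<noteq> x (P \<epsilon> g (Suc 0))"
    using fixed_point_metastable[OF _ \<epsilon>] 0 by blast
  from trapped_later[OF sign_change_trapped[OF k(2)] x_unit k(1) this]
  obtain z where "z \<in> {0..1}" "trapped \<delta> f z (x (P \<epsilon> g (Suc 0)))"
    by blast
  then show ?case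
    using x_unit[of "P \<epsilon> g (Suc 0)"] by (intro bexI[of _ z]) auto
next
  case (Suc n)
  define b where "b = P \<epsilon> g (Suc (Suc n))"
  have le: "P \<epsilon> g (Suc n) \<le> b"
    unfolding b_def using mono_P by (rule monoD) simp
  have nofix: "f (x i) \<noteq> x i" if "i \<le> b" for i
    using fixed_point_metastable[OF _ \<epsilon>] Suc.prems that by (auto simp: b_def)
  obtain y where y: "y \<in> {0..1}" "trapped \<delta> f y (x (P \<epsilon> g (Suc n)))"
      "\<bar>x (P \<epsilon> g (Suc n)) - y\<bar> \<le> (1 - \<delta>) ^ n"
    using Suc.IH Suc.prems le by (metis b_def order_trans)
  obtain k where k: "P \<epsilon> g (Suc n) \<le> k" "Suc k \<le> b"
      "(f (x k) - x k) * (f (x (Suc k)) - x (Suc k)) < 0"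
    using sign_change_exists[OF \<epsilon> Suc.prems] unfolding b_def by blast
  obtain z where z: "z \<in> {0..1}" "trapped \<delta> f z (x k)"
      "\<bar>x k - z\<bar> \<le> \<bar>x (P \<epsilon> g (Suc n)) - y\<bar>"
    using trapped_later[OF y(2,1) k(1)] nofix[of k] k(2) by auto
  obtain w where w: "w \<in> {0..1}" "trapped \<delta> f w (x b)" "\<bar>x b - w\<bar> \<le> \<bar>x (Suc k) - x k\<bar>"
    using trapped_later[OF sign_change_trapped[OF k(3)] x_unit k(2)] nofix[of b] by auto
  note w(3)
  also have "\<bar>x (Suc k) - x k\<bar> \<le> (1 - \<delta>) * \<bar>x k - z\<bar>"
    using z by (intro trapped_step_le)
  also have "\<dots> \<le> (1 - \<delta>) * (1 - \<delta>) ^ n"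
    using z(3) y(3) \<delta>_less by (intro mult_left_mono) auto
  finally show ?case
    using w(1,2) by (auto simp: b_def)
qed

end

text \<open>\<open>T \<epsilon> \<delta>\<close> is defined with the base \<open>1 - \<delta> / 2\<close>, which is larger than the contraction factor
  \<open>1 - \<delta>\<close> of the traps.\<close>

lemma power_T_le:
  assumes "0 < \<delta>" "\<delta> < 1" "0 < \<epsilon>" "\<epsilon> < 1"
  shows "\<exists>n. T \<epsilon> \<delta> = Suc n \<and> (1 - \<delta>) ^ n \<le> \<epsilon>"
proof -
  define c where "c = 1 - \<delta> / 2"
  have c: "0 < c" "c < 1"
    using assms by (auto simp: c_def)
  define n where "n = nat \<lceil>log c \<epsilon>\<rceil>"
  have "log c \<epsilon> > 0"
    using c assms by (simp add: log_def divide_neg_neg)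
  then have "T \<epsilon> \<delta> = Suc n" and n: "log c \<epsilon> \<le> real n"
    unfolding T_def n_def c_def[symmetric] by linarith+
  have "(1 - \<delta>) ^ n \<le> c ^ n"
    using assms by (intro power_mono) (auto simp: c_def)
  also have "\<dots> = c powr real n"
    using c by (simp add: powr_realpow)
  also have "\<dots> \<le> c powr log c \<epsilon>"
    using c n by (intro powr_mono') auto
  also have "\<dots> = \<epsilon>"
    using c assms by simp
  finally show ?thesis
    using \<open>T \<epsilon> \<delta> = Suc n\<close> by blast
qed

theorem theorem4p4:
  fixes L \<delta> \<epsilon> :: real
    and f :: "real \<Rightarrow> real"
    and t x :: "nat \<Rightarrow> real"
    and g :: "nat \<Rightarrow> nat"
  assumes "L > 0"
    and "f ` {0..1} \<subseteq> {0..1}"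
    and "L-lipschitz_on {0..1} f"
    and "\<And>n. t n \<in> {0..1}"
    and "\<And>n. x n \<in> {0..1}"
    and "\<And>n. x (Suc n) = (1 - t n) * x n + t n * f (x n)"
    and "0 < \<delta>" and "\<delta> < 1"
    and "\<And>n. t n \<le> (2 - \<delta>) / (L + 1)"
    and "\<epsilon> > 0"
  shows "\<exists>N \<le> Psi_KM \<delta> \<epsilon> g. \<forall>i \<in> {N..N + g N}. \<forall>j \<in> {N..N + g N}. \<bar>x i - x j\<bar> \<le> \<epsilon>"
proof (cases "\<epsilon> < 1")
  case True
  interpret krasnoselskii_mann L \<delta> f t x
    using assms by unfold_locales auto
  obtain n where n: "T \<epsilon> \<delta> = Suc n" "(1 - \<delta>) ^ n \<le> \<epsilon>"
    using power_T_le[OF assms(7,8,10) True] by blast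
  have "\<exists>N \<le> P \<epsilon> g (Suc n). metastable \<epsilon> g x N"
  proof (rule ccontr)
    assume bad: "\<not> ?thesis"
    then obtain y where "y \<in> {0..1}" "trapped \<delta> f y (x (P \<epsilon> g (Suc n)))"
        "\<bar>x (P \<epsilon> g (Suc n)) - y\<bar> \<le> (1 - \<delta>) ^ n"
      using trap_width[OF assms(10), of g n] by blast
    with n(2) have "metastable \<epsilon> g x (P \<epsilon> g (Suc n))"
      by (intro trapped_metastable) auto
    with bad show False
      by blast
  qed
  moreover have "P \<epsilon> g (Suc n) \<le> Psi_KM \<delta> \<epsilon> g"
    unfolding Psi_KM_def using mono_P by (rule monoD) (simp add: B_def n(1))
  ultimately show ?thesis
    unfolding metastable_def by (meson order_trans)
next
  case False
  have "\<bar>x i - x j\<bar> \<le> \<epsilon>" for i j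
    using False assms(5)[of i] assms(5)[of j] by auto
  then show ?thesis
    by blast
qed

end
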